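(* Let $q$ be a prime power, $\ell>1$, $d<\ell$, and suppose $m:=\ell-d+1$ divides $\ell$. With $s=0$ and $r=2$, the construction described in the context provides a code ${\rm RS}(\mathcal{A},q^d-2)$ over $\mathbb{F}_{q^\ell}$, where $\mathcal{A}$ is a $d$-dimensional $\mathbb{F}_q$-subspace of $\mathbb{F}_{q^\ell}$, and a corresponding linear repair scheme. With $n=q^d$, the I/O cost of that linear repair scheme (with respect to the basis $\mathcal{B}$ of the construction) is $$(n-1)\ell-(\ell-d+1)q^{d-1},$$ which is optimal, i.e. no linear repair scheme over $\mathbb{F}_q$ for ${\rm RS}(\mathcal{A},q^d-2)$ has a smaller I/O cost with respect to any basis.
   Context: General definitions. Let $B=\mathbb{F}_q$, $F=\mathbb{F}_{q^\ell}$, ${\rm Tr}_{F/B}$ the trace, $K={\rm Ker}({\rm Tr}_{F/B})$. For $\mathcal{A}=\{\alpha_1,\dots,\alpha_n\}\subseteq F$ and $1\le k<n$, ${\rm RS}(\mathcal{A},k)=\{(f(\alpha_1),\dots,f(\alpha_n)): f\in F[x],\ \deg f\le k-1\}$; coordinate $i$ is called node $i$, and "node $0$" means the coordinate with evaluation point $0$. When $\mathcal{A}$ is a $B$-linear subspace of $F$, ${\rm RS}(\mathcal{A},k)^\perp={\rm RS}(\mathcal{A},n-k)$. A linear repair scheme (over $B$) for node $i^*$ of ${\rm RS}(\mathcal{A},k)$ is a list of $\ell$ polynomials $g_1,\dots,g_\ell\in F[x]$ of degree less than $n-k$ such that $g_1(\alpha_{i^*}),\dots,g_\ell(\alpha_{i^*})$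 are linearly independent over $B$. Given a basis $\mathcal{B}=\{\beta^{(1)},\dots,\beta^{(\ell)}\}$ of $F$ over $B$, let $W_i$ be the $\ell\times\ell$ matrix over $B$ whose $(j,\nu)$ entry is ${\rm Tr}_{F/B}(g_j(\alpha_i)\beta^{(\nu)})$. The I/O cost with respect to $\mathcal{B}$ is $\gamma_{I/O}=\sum_{i=1}^n{\rm nz}(W_i)-\ell=\sum_{i\ne i^*}{\rm nz}(W_i)$, where ${\rm nz}(W)$ is the number of nonzero columns of $W$. Construction (written for $s=0$, $r=2$, $m=\ell-d+1$). (1) Let $\{\gamma^{(1)}=1,\gamma^{(2)},\dots,\gamma^{(m)}\}$ be a basis of $\mathbb{F}_{q^m}$ over $B$ and $\{\lambda_1=1,\lambda_2,\dots,\lambda_{\ell/m}\}$ a basis of $F$ over $\mathbb{F}_{q^m}$. Set $\gamma^{((i-1)m+j)}=\lambda_i\gamma^{(j)}$ for $1\le i\le\ell/m$, $1\le j\le m$; then $\{\gamma^{(1)},\dots,\gamma^{(\ell)}\}$ is a basis of $F$ over $B$. Let $\mathcal{B}=\{\beta^{(1)},\dots,\beta^{(\ell)}\}$ be its dual basis, i.e. ${\rm Tr}_{F/B}(\beta^{(i)}\gamma^{(j)})=1$ if $i=j$ and $0$ otherwise. (2) Let $L(x)=\alpha x$ with an arbitrary $\alpha\in F\setminus\{0\}$, let $W=\bigcap_{i=2}^{\ell-d+1}(\beta^{(i)})^{-1}K$, and $\mathcal{A}=L^{-1}(W)$, a $d$-dimensional $B$-subspace of $F$. (3) The repair scheme for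 node $0$ is $g_j(x)=\gamma^{(j)}L(x)+\gamma^{(j)}$ for $1\le j\le m$ and $g_j(x)=\gamma^{(j)}$ for $m+1\le j\le\ell$. *)

theory Defs
  imports
    "HOL-Computational_Algebra.Computational_Algebra"
    "HOL-Number_Theory.Prime_Powers"
begin

text \<open>
  The large field \<open>F\<close> of order \<open>q ^ l\<close> is the whole type; its subfields are sets. Families of
  vectors, and lists of polynomials, are functions on \<open>nat\<close>, used only on \<open>{1..l}\<close> (or
  \<open>{1..m}\<close> etc.).
\<close>

definition is_subfield :: "'a::field set \<Rightarrow> bool" where
  "is_subfield S \<longleftrightarrow> 0 \<in> S \<and> 1 \<in> S \<and>
     (\<forall>x\<in>S. \<forall>y\<in>S. x + y \<in> S \<and> x * y \<in> S) \<and>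
     (\<forall>x\<in>S. - x \<in> S \<and> inverse x \<in> S)"

definition lin_indep_over :: "'a::field set \<Rightarrow> (nat \<Rightarrow> 'a) \<Rightarrow> nat set \<Rightarrow> bool" where
  "lin_indep_over S v I \<longleftrightarrow>
     (\<forall>c. (\<forall>i\<in>I. c i \<in> S) \<longrightarrow> (\<Sum>i\<in>I. c i * v i) = 0 \<longrightarrow> (\<forall>i\<in>I. c i = 0))"

definition span_over :: "'a::field set \<Rightarrow> (nat \<Rightarrow> 'a) \<Rightarrow> nat set \<Rightarrow> 'a set" where
  "span_over S v I = {\<Sum>i\<in>I. c i * v i | c. \<forall>i\<in>I. c i \<in> S}"

definition basis_over :: "'a::field set \<Rightarrow> (nat \<Rightarrow> 'a) \<Rightarrow> nat set \<Rightarrow> 'a set \<Rightarrow> bool" where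
  "basis_over S v I V \<longleftrightarrow> lin_indep_over S v I \<and> span_over S v I = V"

definition subspace_of_dim :: "'a::field set \<Rightarrow> nat \<Rightarrow> 'a set \<Rightarrow> bool" where
  "subspace_of_dim S d V \<longleftrightarrow>
     0 \<in> V \<and> (\<forall>x\<in>V. \<forall>y\<in>V. x + y \<in> V) \<and> (\<forall>c\<in>S. \<forall>x\<in>V. c * x \<in> V) \<and>
     (\<exists>v. basis_over S v {1..d} V)"

text \<open>
  For \<open>F\<close> of order \<open>q ^ l\<close> over its subfield \<open>B\<close> of order \<open>q\<close>, the trace is the sum of the
  conjugates; its values are elements of \<open>B\<close>, seen in \<open>F\<close>.
\<close>

definition field_trace :: "nat \<Rightarrow> nat \<Rightarrow> 'a::field \<Rightarrow> 'a" where
  "field_trace q l x = (\<Sum>i<l. x ^ (q ^ i))"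

definition trace_kernel :: "nat \<Rightarrow> nat \<Rightarrow> 'a::field set" where
  "trace_kernel q l = {x. field_trace q l x = 0}"

definition trace_dual :: "nat \<Rightarrow> nat \<Rightarrow> (nat \<Rightarrow> 'a::field) \<Rightarrow> (nat \<Rightarrow> 'a) \<Rightarrow> bool" where
  "trace_dual q l \<beta> \<gamma> \<longleftrightarrow>
     (\<forall>i\<in>{1..l}. \<forall>j\<in>{1..l}. field_trace q l (\<beta> i * \<gamma> j) = (if i = j then 1 else 0))"

text \<open>
  The nodes of a Reed-Solomon code are identified with the evaluation points: a codeword is a
  function on the evaluation set \<open>A\<close>, taken to be \<open>0\<close> outside \<open>A\<close>. The disjunct \<open>f = 0\<close> only
  matters for \<open>k = 0\<close>, where it gives the zero code.
\<close>

definition RS_code :: "'a::field set \<Rightarrow> nat \<Rightarrow> ('a \<Rightarrow> 'a) set" where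
  "RS_code A k =
     {\<lambda>x. if x \<in> A then poly f x else 0 | f. f = 0 \<or> degree f < k}"

definition linear_repair_scheme ::
    "'a::field set \<Rightarrow> nat \<Rightarrow> 'a set \<Rightarrow> nat \<Rightarrow> 'a \<Rightarrow> (nat \<Rightarrow> 'a poly) \<Rightarrow> bool" where
  \<comment> \<open>\<open>g\<close> is a linear repair scheme over \<open>B\<close> for the node \<open>a\<close> of \<open>RS_code A k\<close>\<close>
  "linear_repair_scheme B l A k a g \<longleftrightarrow> a \<in> A \<and>
     (\<forall>j\<in>{1..l}. degree (g j) < card A - k) \<and>
     lin_indep_over B (\<lambda>j. poly (g j) a) {1..l}"

definition repair_matrix ::
    "nat \<Rightarrow> nat \<Rightarrow> (nat \<Rightarrow> 'a::field) \<Rightarrow> (nat \<Rightarrow> 'a poly) \<Rightarrow> 'a \<Rightarrow> nat \<Rightarrow> nat \<Rightarrow> 'a" where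
  "repair_matrix q l \<beta> g x j \<nu> = field_trace q l (poly (g j) x * \<beta> \<nu>)"

definition nonzero_columns :: "nat \<Rightarrow> (nat \<Rightarrow> nat \<Rightarrow> 'a::zero) \<Rightarrow> nat" where
  "nonzero_columns l M = card {\<nu>\<in>{1..l}. \<exists>j\<in>{1..l}. M j \<nu> \<noteq> 0}"

definition io_cost ::
    "nat \<Rightarrow> nat \<Rightarrow> (nat \<Rightarrow> 'a::field) \<Rightarrow> 'a set \<Rightarrow> 'a \<Rightarrow> (nat \<Rightarrow> 'a poly) \<Rightarrow> nat" where
  "io_cost q l \<beta> A a g = (\<Sum>x\<in>A - {a}. nonzero_columns l (repair_matrix q l \<beta> g x))"

text \<open>
  The construction with \<open>m = l - d + 1\<close>: the evaluation set is the preimage of \<open>constr_W\<close> under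
  \<open>L(x) = \<alpha> x\<close>, and the repaired node is \<open>0\<close>.
\<close>

definition constr_L :: "'a::field \<Rightarrow> 'a poly" where
  "constr_L \<alpha> = [:0, \<alpha>:]"

definition constr_W :: "nat \<Rightarrow> nat \<Rightarrow> nat \<Rightarrow> (nat \<Rightarrow> 'a::field) \<Rightarrow> 'a set" where
  "constr_W q l d \<beta> =
     (\<Inter>i\<in>{2..l - d + 1}. (\<lambda>x. inverse (\<beta> i) * x) ` trace_kernel q l)"

definition constr_A :: "nat \<Rightarrow> nat \<Rightarrow> nat \<Rightarrow> (nat \<Rightarrow> 'a::field) \<Rightarrow> 'a \<Rightarrow> 'a set" where
  "constr_A q l d \<beta> \<alpha> = {x. poly (constr_L \<alpha>) x \<in> constr_W q l d \<beta>}"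

definition constr_scheme :: "nat \<Rightarrow> (nat \<Rightarrow> 'a::field) \<Rightarrow> 'a \<Rightarrow> nat \<Rightarrow> 'a poly" where
  "constr_scheme m \<gamma> \<alpha> j =
     (if j \<le> m then smult (\<gamma> j) (constr_L \<alpha>) + [:\<gamma> j:] else [:\<gamma> j:])"

end

theory Submission
  imports Defs
begin

text \<open>
  The polynomials of a repair scheme have degree at most 1, so the condition that column \<open>\<nu>\<close>
  vanishes at the node \<open>a + t\<close> is an affine \<open>B\<close>-linear system in \<open>t\<close>, and the cost is \<open>(n - 1) l\<close>
  minus the number of solutions \<open>t \<noteq> 0\<close>. If \<open>N\<close> of the \<open>l\<close> systems are solvable, each of them has at most
  \<open>q ^ min (d - 1) (l - N)\<close> solutions, and \<open>N * q ^ min (d - 1) (l - N)\<close> is largest for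
  \<open>N = l - d + 1\<close>. In the construction, exactly the systems of the columns \<open>1, \<dots>, l - d + 1\<close> are
  solvable, all with the same \<open>q ^ (d - 1)\<close> solutions.
\<close>

section \<open>Linear combinations, independence and spans over a subfield\<close>

lemma is_subfield_diff: "is_subfield S \<Longrightarrow> x \<in> S \<Longrightarrow> y \<in> S \<Longrightarrow> x - y \<in> S"
  by (metis is_subfield_def diff_conv_add_uminus)

lemma lin_indep_overD:
  "lin_indep_over S v I \<Longrightarrow> (\<And>i. i \<in> I \<Longrightarrow> c i \<in> S) \<Longrightarrow> (\<Sum>i\<in>I. c i * v i) = 0 \<Longrightarrow> i \<in> I \<Longrightarrow> c i = 0"
  unfolding lin_indep_over_def by blast

text \<open>Extensional functions in \<open>I \<rightarrow>\<^sub>E S\<close> represent each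
  coefficient vector exactly once, so independence becomes injectivity and the elements of a span
  can be counted.\<close>

lemma lin_comb_inj_on:
  assumes "is_subfield S" "lin_indep_over S v I"
  shows "inj_on (\<lambda>c. \<Sum>i\<in>I. c i * v i) (I \<rightarrow>\<^sub>E S)"
proof (rule inj_onI)
  fix c c' assume c: "c \<in> I \<rightarrow>\<^sub>E S" "c' \<in> I \<rightarrow>\<^sub>E S"
    and eq: "(\<Sum>i\<in>I. c i * v i) = (\<Sum>i\<in>I. c' i * v i)"
  have "(\<Sum>i\<in>I. (c i - c' i) * v i) = 0"
    using eq by (simp add: left_diff_distrib sum_subtractf)
  moreover have "\<forall>i\<in>I. c i - c' i \<in> S"
    using c is_subfield_diff[OF assms(1)] by (auto simp: PiE_iff)
  ultimately have "\<forall>i\<in>I. c i - c' i = 0"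
    using lin_indep_overD[OF assms(2), of "\<lambda>i. c i - c' i"] by blast
  then show "c = c'" using c by (intro PiE_ext[of c I "\<lambda>_. S" c']) auto
qed

lemma span_over_eq_image: "span_over S v I = (\<lambda>c. \<Sum>i\<in>I. c i * v i) ` (I \<rightarrow>\<^sub>E S)"
proof
  show "span_over S v I \<subseteq> (\<lambda>c. \<Sum>i\<in>I. c i * v i) ` (I \<rightarrow>\<^sub>E S)"
  proof
    fix x assume "x \<in> span_over S v I"
    then obtain c where "\<forall>i\<in>I. c i \<in> S" "x = (\<Sum>i\<in>I. c i * v i)"
      by (auto simp: span_over_def)
    then show "x \<in> (\<lambda>c. \<Sum>i\<in>I. c i * v i) ` (I \<rightarrow>\<^sub>E S)"
      by (intro image_eqI[of _ _ "restrict c I"]) auto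
  qed
qed (auto simp: span_over_def PiE_iff)

lemma card_span_over:
  assumes "is_subfield S" "lin_indep_over S v I" "finite I"
  shows "card (span_over S v I) = card S ^ card I"
  using assms by (simp add: span_over_eq_image card_image[OF lin_comb_inj_on] card_funcsetE)

text \<open>A basis of a \<open>d\<close>-dimensional subspace has to be indexed by
  \<open>{1..d}\<close>, whereas the evaluation set of the construction is spanned by basis vectors
  with a gap in their indices; this lemma and the next carry span and independence over.\<close>

lemma span_over_reindex:
  assumes "inj_on h I"
  shows "span_over S v (h ` I) = span_over S (\<lambda>i. v (h i)) I"
proof -
  have "(\<exists>c. x = (\<Sum>i\<in>h ` I. c i * v i) \<and> (\<forall>i\<in>h ` I. c i \<in> S)) \<longleftrightarrow>
      (\<exists>c. x = (\<Sum>i\<in>I. c i * v (h i)) \<and> (\<forall>i\<in>I. c i \<in> S))" for x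
  proof
    assume "\<exists>c. x = (\<Sum>i\<in>I. c i * v (h i)) \<and> (\<forall>i\<in>I. c i \<in> S)"
    then obtain c where "x = (\<Sum>i\<in>I. c i * v (h i))" "\<forall>i\<in>I. c i \<in> S" by blast
    then show "\<exists>c. x = (\<Sum>i\<in>h ` I. c i * v i) \<and> (\<forall>i\<in>h ` I. c i \<in> S)"
      using assms by (intro exI[of _ "\<lambda>i. c (the_inv_into I h i)"])
        (simp add: sum.reindex the_inv_into_f_f)
  qed (use assms in \<open>force simp: sum.reindex\<close>)
  then show ?thesis unfolding span_over_def by blast
qed

lemma lin_indep_over_reindex:
  assumes "inj_on h I" "lin_indep_over S v (h ` I)"
  shows "lin_indep_over S (\<lambda>i. v (h i)) I"
  unfolding lin_indep_over_def
proof (intro allI impI)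
  fix c assume c: "\<forall>i\<in>I. c i \<in> S" "(\<Sum>i\<in>I. c i * v (h i)) = 0"
  let ?c = "\<lambda>i. c (the_inv_into I h i)"
  have "\<forall>i\<in>h ` I. ?c i \<in> S" "(\<Sum>i\<in>h ` I. ?c i * v i) = 0"
    using c assms(1) by (simp_all add: sum.reindex the_inv_into_f_f)
  then have "\<forall>i\<in>h ` I. ?c i = 0"
    using lin_indep_overD[OF assms(2), of ?c] by blast
  then show "\<forall>i\<in>I. c i = 0" using assms(1) by (simp add: the_inv_into_f_f)
qed

lemma lin_indep_over_subset:
  assumes "lin_indep_over S v I" "J \<subseteq> I" "finite I" "is_subfield S"
  shows "lin_indep_over S v J"
  unfolding lin_indep_over_def
proof (intro allI impI)
  fix c assume c: "\<forall>i\<in>J. c i \<in> S" "(\<Sum>i\<in>J. c i * v i) = 0"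
  let ?c = "\<lambda>i. if i \<in> J then c i else 0"
  have "(\<Sum>i\<in>I. ?c i * v i) = (\<Sum>i\<in>J. c i * v i)"
    using assms(2,3) by (intro sum.mono_neutral_cong_right) auto
  moreover have "\<forall>i\<in>I. ?c i \<in> S" using c assms(4) by (auto simp: is_subfield_def)
  ultimately have "\<forall>i\<in>I. ?c i = 0"
    using c lin_indep_overD[OF assms(1), of ?c] by metis
  then show "\<forall>i\<in>J. c i = 0" using assms(2) by (auto split: if_splits)
qed

lemma span_overI: "(\<And>i. i \<in> I \<Longrightarrow> c i \<in> S) \<Longrightarrow> (\<Sum>i\<in>I. c i * v i) \<in> span_over S v I"
  unfolding span_over_def by blast

lemma span_over_add:
  assumes "is_subfield S" "x \<in> span_over S v I" "y \<in> span_over S v I"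
  shows "x + y \<in> span_over S v I"
proof -
  obtain c c' where c: "\<forall>i\<in>I. c i \<in> S" "x = (\<Sum>i\<in>I. c i * v i)"
    and c': "\<forall>i\<in>I. c' i \<in> S" "y = (\<Sum>i\<in>I. c' i * v i)"
    using assms(2,3) unfolding span_over_def by blast
  have "x + y = (\<Sum>i\<in>I. (c i + c' i) * v i)" using c c' by (simp add: distrib_right sum.distrib)
  also have "\<dots> \<in> span_over S v I"
    by (rule span_overI) (use c(1) c'(1) assms(1) in \<open>auto simp: is_subfield_def\<close>)
  finally show ?thesis .
qed

lemma span_over_scale:
  assumes "is_subfield S" "a \<in> S" "x \<in> span_over S v I"
  shows "a * x \<in> span_over S v I"
proof -
  obtain c where c: "\<forall>i\<in>I. c i \<in> S" "x = (\<Sum>i\<in>I. c i * v i)"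
    using assms(3) unfolding span_over_def by blast
  have "a * x = (\<Sum>i\<in>I. (a * c i) * v i)" using c by (simp add: sum_distrib_left mult.assoc)
  also have "\<dots> \<in> span_over S v I"
    by (rule span_overI) (use c(1) assms(1,2) in \<open>auto simp: is_subfield_def\<close>)
  finally show ?thesis .
qed

lemma span_over_superset:
  assumes "is_subfield S" "finite I" "i \<in> I"
  shows "v i \<in> span_over S v I"
proof -
  have "v i = (\<Sum>k\<in>I. if k = i then v k else 0)"
    using assms(2,3) by simp
  also have "\<dots> = (\<Sum>k\<in>I. (if k = i then 1 else 0) * v k)"
    by (rule sum.cong) simp_all
  also have "\<dots> \<in> span_over S v I" by (rule span_overI) (use assms(1) in \<open>simp add: is_subfield_def\<close>)
  finally show ?thesis .
qed

lemma subspace_of_dim_span_over: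
  assumes S: "is_subfield S" and v: "lin_indep_over S v {1..d}"
  shows "subspace_of_dim S d (span_over S v {1..d})"
proof -
  have "(\<Sum>i\<in>{1..d}. 0 * v i) \<in> span_over S v {1..d}"
    by (rule span_overI) (use S in \<open>simp add: is_subfield_def\<close>)
  then have "0 \<in> span_over S v {1..d}" by simp
  moreover have "basis_over S v {1..d} (span_over S v {1..d})"
    using v by (simp add: basis_over_def)
  ultimately show ?thesis
    unfolding subspace_of_dim_def using span_over_add[OF S] span_over_scale[OF S] by metis
qed

lemma lin_indep_over_mult_right:
  fixes a :: "'a::field"
  assumes "lin_indep_over S v I" "a \<noteq> 0"
  shows "lin_indep_over S (\<lambda>i. v i * a) I"
  unfolding lin_indep_over_def
proof (intro allI impI)
  fix c assume c: "\<forall>i\<in>I. c i \<in> S" "(\<Sum>i\<in>I. c i * (v i * a)) = 0"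
  have "(\<Sum>i\<in>I. c i * v i) * a = 0" using c(2) by (simp add: sum_distrib_right mult.assoc)
  then have "(\<Sum>i\<in>I. c i * v i) = 0" using assms(2) by simp
  then show "\<forall>i\<in>I. c i = 0" using c(1) assms(1) unfolding lin_indep_over_def by blast
qed

lemma span_over_mult_right: "span_over S (\<lambda>i. v i * a) I = (\<lambda>x. x * a) ` span_over S v I"
  unfolding span_over_eq_image image_image by (simp add: sum_distrib_right mult.assoc)

section \<open>Power and sum identities in finite fields\<close>

text \<open>Translation by 1 permutes the ring, so adding 1 to every element leaves the sum of all
  elements unchanged.\<close>

lemma of_nat_card_UNIV_eq_0: "of_nat (card (UNIV :: 'a::{finite,comm_ring_1} set)) = (0 :: 'a)"
proof -
  have "(\<Sum>x\<in>UNIV. x + 1) = (\<Sum>x\<in>(UNIV::'a set). x)"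
    by (rule sum.reindex_bij_witness[of _ "\<lambda>x. x - 1" "\<lambda>x. x + 1"]) auto
  then show ?thesis by (simp add: sum.distrib)
qed

text \<open>Multiplication by a nonzero \<open>c\<close> permutes the nonzero elements of
  \<open>S\<close>; comparing the products of these elements gives
  \<open>c ^ (card S - 1) = 1\<close>.\<close>

lemma is_subfield_power_card:
  fixes c :: "'a::{field,finite}"
  assumes S: "is_subfield S" and c: "c \<in> S"
  shows "c ^ card S = c"
proof (cases "c = 0")
  case False
  have fin: "finite S" and S0: "0 \<in> S" using S by (auto simp: is_subfield_def)
  have cl: "c * y \<in> S" "y / c \<in> S" if "y \<in> S" for y
    using S c that unfolding is_subfield_def divide_inverse by blast+
  have "(\<Prod>y\<in>S - {0}. c * y) = \<Prod>(S - {0})"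
    using False cl
    by (intro prod.reindex_bij_witness[of _ "\<lambda>y. y / c" "\<lambda>y. c * y"]) auto
  then have "c ^ card (S - {0}) * \<Prod>(S - {0}) = 1 * \<Prod>(S - {0})"
    by (simp add: prod.distrib)
  moreover have "\<Prod>(S - {0}) \<noteq> 0" using fin by simp
  ultimately have "c ^ card (S - {0}) = 1" by simp
  moreover have "card S = Suc (card (S - {0}))"
    using fin S0 by (rule card.remove)
  ultimately show ?thesis by simp
next
  case True
  have "card S \<noteq> 0" using S by (auto simp: is_subfield_def)
  then show ?thesis using True by (simp add: power_0_left)
qed

text \<open>
  On an additive subgroup all denominators in the Lagrange interpolation formula are equal to the
  product of the nonzero elements, so the top coefficient of the interpolation polynomial is
  proportional to the sum of the values.
\<close>

lemma sum_poly_additive_subgroup_eq_0: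
  fixes A :: "'a::field set"
  assumes fin: "finite A" and diff: "\<And>x y. x \<in> A \<Longrightarrow> y \<in> A \<Longrightarrow> x - y \<in> A"
    and deg: "degree f + 1 < card A"
  shows "(\<Sum>x\<in>A. poly f x) = 0"
proof -
  define P where "P = \<Prod>(A - {0})"
  have P: "P \<noteq> 0" using fin by (simp add: P_def)
  define l where "l = (\<lambda>x. \<Prod>y\<in>A - {x}. [:- y, 1:])"
  have deg_l: "degree (l x) = card A - 1" if "x \<in> A" for x
    using that fin by (simp add: l_def degree_prod_sum_eq)
  have coeff_l: "coeff (l x) (card A - 1) = 1" if "x \<in> A" for x
  proof -
    have "lead_coeff (l x) = 1" by (simp add: l_def lead_coeff_prod)
    then show ?thesis by (simp add: deg_l[OF that])
  qed
  have l_eq: "poly (l x) x = P" if "x \<in> A" for x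
    unfolding l_def P_def poly_prod
    by (rule prod.reindex_bij_witness[of _ "\<lambda>z. x - z" "\<lambda>y. x - y"]) (use that diff in auto)
  have l_neq: "poly (l x) y = 0" if "x \<in> A" "y \<in> A" "x \<noteq> y" for x y
    using that fin by (auto simp: l_def poly_prod)
  define h where "h = (\<Sum>x\<in>A. smult (poly f x / P) (l x))"
  have "poly h y = poly f y" if y: "y \<in> A" for y
  proof -
    have "poly h y = (\<Sum>x\<in>A. if x = y then poly f y else 0)"
      unfolding h_def poly_sum by (rule sum.cong) (use y l_eq l_neq P in auto)
    then show ?thesis using y fin by simp
  qed
  moreover have "degree h \<le> card A - 1"
    unfolding h_def using fin deg_l
    by (intro degree_sum_le) (auto intro: order.trans[OF degree_smult_le])
  ultimately have "f = h"
    using deg by (intro poly_eqI_degree[of A]) auto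
  \<comment> \<open>The polynomial has degree below \<open>card A - 1\<close>, so the top
    coefficient of the interpolation formula, which is the sum of the values divided by
    \<open>P\<close>, is 0.\<close>
  then have "coeff h (card A - 1) = 0" using deg by (intro coeff_eq_0) auto
  moreover have "coeff h (card A - 1) = (\<Sum>x\<in>A. poly f x / P)"
    unfolding h_def coeff_sum by (rule sum.cong) (use coeff_l in auto)
  ultimately show ?thesis using P by (simp flip: sum_divide_distrib)
qed

section \<open>The extremal inequality, and the cost as a count of zero columns\<close>

lemma add_le_mult_power:
  fixes m q :: nat
  assumes "m \<ge> 1" "q \<ge> 2"
  shows "m + k \<le> m * q ^ k"
proof (induction k)
  case (Suc k)
  have "1 \<le> m * q ^ k" using assms by (simp add: Suc_leI)
  then have "m + Suc k \<le> m * q ^ k * 2" using Suc.IH by linarith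
  also have "\<dots> \<le> m * q ^ Suc k" using assms(2) by simp
  finally show ?case .
qed simp

text \<open>Up to \<open>N = l - d + 1\<close> the bound \<open>q ^ (d - 1)\<close> is constant and
  only the factor \<open>N\<close> grows. Beyond that, \<open>k\<close> further units of
  \<open>N\<close> divide the other bound by \<open>q ^ k\<close>, which outweighs the growth of the
  factor from \<open>l - d + 1\<close> to \<open>l - d + 1 + k\<close>.\<close>

lemma mult_min_power_le:
  fixes q :: nat
  assumes "q \<ge> 2" "1 \<le> d" "d < l" "N \<le> l"
  shows "N * min (q ^ (d - 1)) (q ^ (l - N)) \<le> (l - d + 1) * q ^ (d - 1)"
proof (cases "N \<le> l - d + 1")
  case True
  then show ?thesis by (intro mult_mono) auto
next
  case False
  define k where "k = N - (l - d + 1)"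
  have k: "N = (l - d + 1) + k" "d - 1 = k + (l - N)" using False assms by (auto simp: k_def)
  have "N * min (q ^ (d - 1)) (q ^ (l - N)) \<le> N * q ^ (l - N)" by simp
  also have "\<dots> \<le> (l - d + 1) * q ^ k * q ^ (l - N)"
    unfolding k(1) by (intro mult_right_mono add_le_mult_power) (use assms in auto)
  also have "\<dots> = (l - d + 1) * q ^ (d - 1)" unfolding k(2) by (simp only: power_add mult.assoc)
  finally show ?thesis .
qed

text \<open>Double counting: at each node the \<open>l\<close> columns split into zero and nonzero
  ones, and exchanging the sums counts the zero ones column by column. The additive form avoids
  truncated subtraction.\<close>

lemma io_cost_add_zero_columns:
  assumes "finite A" "a \<in> A"
  shows "io_cost q l \<beta> A a g +
      (\<Sum>\<nu>\<in>{1..l}. card {x\<in>A - {a}. \<forall>j\<in>{1..l}. field_trace q l (poly (g j) x * \<beta> \<nu>) = 0}) =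
    (card A - 1) * l"
proof -
  define Z where "Z = (\<lambda>x \<nu>. \<forall>j\<in>{1..l}. field_trace q l (poly (g j) x * \<beta> \<nu>) = 0)"
  have fin: "finite (A - {a})" using assms by simp
  have *: "nonzero_columns l (repair_matrix q l \<beta> g x) + card {\<nu>\<in>{1..l}. Z x \<nu>} = l" for x
  proof -
    have "card ({\<nu>\<in>{1..l}. \<not> Z x \<nu>} \<union> {\<nu>\<in>{1..l}. Z x \<nu>}) =
        card {\<nu>\<in>{1..l}. \<not> Z x \<nu>} + card {\<nu>\<in>{1..l}. Z x \<nu>}"
      by (rule card_Un_disjoint) auto
    moreover have "{\<nu>\<in>{1..l}. \<not> Z x \<nu>} \<union> {\<nu>\<in>{1..l}. Z x \<nu>} = {1..l}" by auto
    ultimately show ?thesis by (simp add: nonzero_columns_def repair_matrix_def Z_def)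
  qed
  have "(\<Sum>\<nu>\<in>{1..l}. card {x\<in>A - {a}. Z x \<nu>}) = (\<Sum>\<nu>\<in>{1..l}. \<Sum>x\<in>A - {a}. if Z x \<nu> then 1 else 0)"
    using fin by (simp flip: sum.inter_filter)
  also have "\<dots> = (\<Sum>x\<in>A - {a}. \<Sum>\<nu>\<in>{1..l}. if Z x \<nu> then 1 else 0)" by (rule sum.swap)
  also have "\<dots> = (\<Sum>x\<in>A - {a}. card {\<nu>\<in>{1..l}. Z x \<nu>})"
    by (simp flip: sum.inter_filter)
  finally have "io_cost q l \<beta> A a g + (\<Sum>\<nu>\<in>{1..l}. card {x\<in>A - {a}. Z x \<nu>}) =
      (\<Sum>x\<in>A - {a}. nonzero_columns l (repair_matrix q l \<beta> g x) + card {\<nu>\<in>{1..l}. Z x \<nu>})"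
    by (simp only: io_cost_def sum.distrib)
  also have "\<dots> = (card A - 1) * l" unfolding * using assms by simp
  finally show ?thesis unfolding Z_def .
qed

section \<open>The trace form and dual bases\<close>

locale trace_field =
  fixes B :: "'a::finite_field set" and q l :: nat
  assumes q: "primepow q" and card_UNIV_eq: "card (UNIV :: 'a set) = q ^ l"
    and B: "is_subfield B" and card_B: "card B = q"
begin

abbreviation tr :: "'a \<Rightarrow> 'a" where "tr \<equiv> field_trace q l"

lemma q_ge_2: "q \<ge> 2"
  using primepow_gt_Suc_0[OF q] by simp

text \<open>If \<open>q\<close> is a power of the prime \<open>p\<close>, then the order of the
  field is one too and is 0 in the field, so \<open>p\<close> is 0 there. This makes the maps
  \<open>x ^ (q ^ i)\<close>, and hence the trace, additive.\<close>

lemma char_power: "\<exists>k. q = CHAR('a) ^ k"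
proof -
  obtain p k where p: "prime p" "q = p ^ k" using q by (auto simp: primepow_def)
  have "of_nat p = (0::'a)"
    using of_nat_card_UNIV_eq_0[where 'a = 'a] p by (simp add: card_UNIV_eq)
  then have "CHAR('a) dvd p" by (simp add: of_nat_eq_0_iff_char_dvd)
  then have "CHAR('a) = p" using p(1) by (simp add: primes_dvd_imp_eq)
  then show ?thesis using p(2) by blast
qed

lemma trace_add: "tr (x + y) = tr x + tr y"
proof -
  obtain k where k: "q = CHAR('a) ^ k" using char_power ..
  have "(x + y) ^ (q ^ i) = x ^ (q ^ i) + y ^ (q ^ i)" for i
    by (rule freshmans_dream'[of _ "k * i"]) (simp_all add: k power_mult)
  then show ?thesis by (simp add: field_trace_def sum.distrib)
qed

lemma trace_mult_left:
  assumes "c \<in> B"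
  shows "tr (c * x) = c * tr x"
proof -
  have c: "c ^ q = c" using is_subfield_power_card[OF B assms] unfolding card_B .
  have c': "c ^ (q ^ i) = c" for i
  proof (induction i)
    case (Suc i)
    have "c ^ (q ^ Suc i) = (c ^ q) ^ (q ^ i)" by (simp only: power_Suc power_mult)
    then show ?case unfolding c Suc.IH .
  qed simp
  show ?thesis by (simp only: field_trace_def power_mult_distrib sum_distrib_left c')
qed

lemma trace_0: "tr 0 = 0"
  using trace_add[of 0 0] unfolding add_0_left by (rule add_cancel_right_right[THEN iffD1])

lemma trace_diff: "tr (x - y) = tr x - tr y"
  using trace_add[of "x - y" y] unfolding diff_add_cancel by (rule eq_diff_eq[THEN iffD2, OF sym])

lemma trace_sum: "tr (sum f I) = (\<Sum>i\<in>I. tr (f i))"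
  by (induction I rule: infinite_finite_induct) (auto simp: trace_add trace_0)

lemma trace_lin_comb:
  assumes "\<And>i. i \<in> I \<Longrightarrow> c i \<in> B"
  shows "tr (\<Sum>i\<in>I. c i * f i) = (\<Sum>i\<in>I. c i * tr (f i))"
  unfolding trace_sum by (rule sum.cong) (use assms trace_mult_left in auto)

text \<open>An independent family of \<open>l\<close> vectors spans \<open>q ^ l\<close> elements,
  as many as the field has.\<close>

lemma span_over_UNIV:
  assumes "lin_indep_over B v {1..l}"
  shows "span_over B v {1..l} = UNIV"
  using card_span_over[OF B assms] card_UNIV_eq by (intro card_eq_UNIV_imp_eq_UNIV) (auto simp: card_B)

lemma trace_dual_commute: "trace_dual q l \<beta> \<gamma> \<Longrightarrow> trace_dual q l \<gamma> \<beta>"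
  unfolding trace_dual_def by (auto simp: mult.commute[of "\<gamma> _"])

lemma trace_dual_coeff:
  assumes "trace_dual q l \<beta> \<gamma>" "I \<subseteq> {1..l}" "i \<in> {1..l}" "\<And>j. j \<in> I \<Longrightarrow> c j \<in> B"
  shows "tr (\<beta> i * (\<Sum>j\<in>I. c j * \<gamma> j)) = (if i \<in> I then c i else 0)"
proof -
  have "tr (\<beta> i * (\<Sum>j\<in>I. c j * \<gamma> j)) = tr (\<Sum>j\<in>I. c j * (\<beta> i * \<gamma> j))"
    by (simp add: sum_distrib_left mult.left_commute)
  also have "\<dots> = (\<Sum>j\<in>I. c j * tr (\<beta> i * \<gamma> j))"
    by (rule trace_lin_comb) (use assms in auto)
  also have "\<dots> = (\<Sum>j\<in>I. if j = i then c j else 0)"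
    by (rule sum.cong) (use assms in \<open>auto simp: trace_dual_def\<close>)
  finally show ?thesis using finite_subset[OF assms(2)] by simp
qed

text \<open>The trace against \<open>\<beta> i\<close> isolates the coefficient of
  \<open>\<gamma> i\<close> in a linear relation, which gives independence; spanning follows by
  counting.\<close>

lemma trace_dual_basis_over:
  assumes "trace_dual q l \<beta> \<gamma>"
  shows "basis_over B \<gamma> {1..l} UNIV"
proof -
  have "lin_indep_over B \<gamma> {1..l}"
    unfolding lin_indep_over_def
  proof (intro allI impI ballI)
    fix c i assume "\<forall>i\<in>{1..l}. c i \<in> B" "(\<Sum>i\<in>{1..l}. c i * \<gamma> i) = 0" "i \<in> {1..l}"
    then show "c i = 0" using trace_dual_coeff[OF assms, of "{1..l}" i c] by (simp add: trace_0)
  qed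
  then show ?thesis unfolding basis_over_def using span_over_UNIV by blast
qed

text \<open>For \<open>y \<noteq> 0\<close>, the element \<open>z / y\<close> is a combination of
  the \<open>v j\<close>, so \<open>z\<close> is a combination of the \<open>v j * y\<close>, all of
  trace 0. A pair of dual bases later supplies \<open>z\<close>.\<close>

lemma trace_nondegenerate:
  assumes v: "lin_indep_over B v {1..l}" and z: "tr z \<noteq> 0"
    and y: "\<And>j. j \<in> {1..l} \<Longrightarrow> tr (v j * y) = 0"
  shows "y = 0"
proof (rule ccontr)
  assume "y \<noteq> 0"
  have "z / y \<in> span_over B v {1..l}" using span_over_UNIV[OF v] by simp
  then obtain c where c: "\<forall>j\<in>{1..l}. c j \<in> B" "z / y = (\<Sum>j\<in>{1..l}. c j * v j)"
    unfolding span_over_def by blast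
  have "z = (\<Sum>j\<in>{1..l}. c j * (v j * y))"
    using c(2) \<open>y \<noteq> 0\<close> by (simp add: mult.assoc[symmetric] flip: sum_distrib_right) (simp add: field_simps)
  then have "tr z = (\<Sum>j\<in>{1..l}. c j * tr (v j * y))"
    using trace_lin_comb[of "{1..l}" c] c(1) by simp
  then show False using y z by simp
qed

section \<open>The lower bound on the cost of an arbitrary scheme\<close>

lemma B_closed: "0 \<in> B" "1 \<in> B" "x \<in> B \<Longrightarrow> y \<in> B \<Longrightarrow> x * y \<in> B"
  using B by (auto simp: is_subfield_def)

text \<open>
  Column \<open>\<nu>\<close> vanishes at \<open>t\<close> iff \<open>T (t * \<beta> \<nu>) = - V (\<beta> \<nu>)\<close>, where \<open>T y\<close> and \<open>V y\<close> are the vectors of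
  the traces of \<open>u j * y\<close> and \<open>v j * y\<close>. Two such \<open>t\<close> differ by an element of the kernel of
  \<open>T\<close> divided by \<open>\<beta> \<nu>\<close>, and \<open>V\<close> is injective; both bounds on the number of \<open>t\<close> come from this.
\<close>

lemma sum_card_zero_columns_le:
  assumes v: "lin_indep_over B v {1..l}" and \<beta>: "lin_indep_over B \<beta> {1..l}" and z: "tr z \<noteq> 0"
    and A_add: "\<And>x y. x \<in> A \<Longrightarrow> y \<in> A \<Longrightarrow> x + y \<in> A"
    and A_scale: "\<And>c x. c \<in> B \<Longrightarrow> x \<in> A \<Longrightarrow> c * x \<in> A"
    and card_A: "card A = q ^ d" and d: "1 \<le> d" "d < l"
  shows "(\<Sum>\<nu>\<in>{1..l}. card {t\<in>A. \<forall>j\<in>{1..l}. tr ((u j * t + v j) * \<beta> \<nu>) = 0})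
    \<le> (l - d + 1) * q ^ (d - 1)"
proof -
  define S where "S \<nu> = {t\<in>A. \<forall>j\<in>{1..l}. tr ((u j * t + v j) * \<beta> \<nu>) = 0}" for \<nu>
  define Z where "Z = {y. \<forall>j\<in>{1..l}. tr (u j * y) = 0}"
  define N where "N = {\<nu>\<in>{1..l}. S \<nu> \<noteq> {}}"
  have N: "N \<subseteq> {1..l}" "finite N" by (auto simp: N_def)
  have SD: "tr (u j * (t * \<beta> \<nu>)) = - tr (v j * \<beta> \<nu>)" if "t \<in> S \<nu>" "j \<in> {1..l}" for j t \<nu>
  proof -
    have "tr (u j * (t * \<beta> \<nu>)) + tr (v j * \<beta> \<nu>) = 0"
      using that unfolding S_def by (simp add: algebra_simps flip: trace_add)
    then show ?thesis by (simp add: eq_neg_iff_add_eq_0)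
  qed
  have m1: "- 1 \<in> B" using B by (auto simp: is_subfield_def)
  have A_diff: "x - y \<in> A" if "x \<in> A" "y \<in> A" for x y
    using A_add[OF that(1) A_scale[OF m1 that(2)]] by simp
  have \<beta>_nz: "\<beta> \<nu> \<noteq> 0" if "\<nu> \<in> {1..l}" for \<nu>
  proof
    assume "\<beta> \<nu> = 0"
    then have "(\<Sum>i\<in>{1..l}. (if i = \<nu> then 1 else 0) * \<beta> i) = 0"
      by (intro sum.neutral) auto
    then have "(if \<nu> = \<nu> then 1 else 0) = (0 :: 'a)"
      by (intro lin_indep_overD[OF \<beta>, of "\<lambda>i. if i = \<nu> then 1 else 0"]) (use B_closed that in auto)
    then show False by simp
  qed
  have card_S_le_Z: "card (S \<nu>) \<le> card Z" if \<nu>N: "\<nu> \<in> N" for \<nu>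
  proof -
    obtain t0 where t0: "t0 \<in> S \<nu>" using \<nu>N unfolding N_def by blast
    have "inj_on (\<lambda>t. (t - t0) * \<beta> \<nu>) (S \<nu>)"
      using \<beta>_nz \<nu>N N by (intro inj_onI) auto
    moreover have "(\<lambda>t. (t - t0) * \<beta> \<nu>) ` S \<nu> \<subseteq> Z"
      using SD t0 by (auto simp: Z_def left_diff_distrib right_diff_distrib trace_diff)
    ultimately show ?thesis by (intro card_inj_on_le) auto
  qed
  have card_S_le: "card (S \<nu>) \<le> q ^ (d - 1)" if \<nu>N: "\<nu> \<in> N" for \<nu>
  proof -
    obtain t0 where t0: "t0 \<in> S \<nu>" using \<nu>N unfolding N_def by blast
    \<comment> \<open>The solution set is a coset, through \<open>t0\<close>, of a subspace of
      \<open>A\<close> that does not contain \<open>t0\<close>. Adding the multiples of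
      \<open>t0\<close> to this subspace therefore multiplies its size by \<open>q\<close> and stays
      inside \<open>A\<close>.\<close>
    let ?f = "\<lambda>(t, c). (t - t0) + c * t0"
    have f_tr: "tr (u j * (((t - t0) + c * t0) * \<beta> \<nu>)) = - (c * tr (v j * \<beta> \<nu>))"
      if "t \<in> S \<nu>" "c \<in> B" "j \<in> {1..l}" for t c j
    proof -
      have "u j * (((t - t0) + c * t0) * \<beta> \<nu>) =
          u j * (t * \<beta> \<nu>) - u j * (t0 * \<beta> \<nu>) + c * (u j * (t0 * \<beta> \<nu>))"
        by (simp add: algebra_simps)
      then show ?thesis using SD[OF that(1,3)] SD[OF t0 that(3)] that(2)
        by (simp add: trace_add trace_diff trace_mult_left)
    qed
    have "inj_on ?f (S \<nu> \<times> B)"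
    proof (rule inj_onI, clarify)
      fix t c t' c' assume *: "t \<in> S \<nu>" "c \<in> B" "t' \<in> S \<nu>" "c' \<in> B"
        and eq: "t - t0 + c * t0 = t' - t0 + c' * t0"
      have "tr (v j * ((c - c') * \<beta> \<nu>)) = 0" if j: "j \<in> {1..l}" for j
      proof -
        have "c * tr (v j * \<beta> \<nu>) = c' * tr (v j * \<beta> \<nu>)"
          using f_tr[OF *(1,2) j] f_tr[OF *(3,4) j] unfolding eq by (metis neg_equal_iff_equal)
        moreover have "tr (v j * ((c - c') * \<beta> \<nu>)) = (c - c') * tr (v j * \<beta> \<nu>)"
          using trace_mult_left[OF is_subfield_diff[OF B *(2,4)], of "v j * \<beta> \<nu>"]
          by (simp add: mult.left_commute)
        ultimately show ?thesis by (simp add: left_diff_distrib)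
      qed
      then have "(c - c') * \<beta> \<nu> = 0" by (rule trace_nondegenerate[OF v z])
      then have "c = c'" using \<beta>_nz \<nu>N N by auto
      then show "t = t' \<and> c = c'" using eq by simp
    qed
    moreover have "?f ` (S \<nu> \<times> B) \<subseteq> A"
      using t0 A_add A_diff A_scale by (auto simp: S_def)
    ultimately have "card (S \<nu> \<times> B) \<le> card A" by (intro card_inj_on_le) auto
    then have "card (S \<nu>) * q \<le> q ^ (d - 1) * q"
      using d by (simp add: card_cartesian_product card_B card_A flip: power_Suc2)
    then show ?thesis using q_ge_2 by simp
  qed
  have card_Z: "card Z * q ^ card N \<le> q ^ l"
  proof -
    have "\<forall>\<nu>\<in>N. \<exists>t. t \<in> S \<nu>" unfolding N_def by blast
    from bchoice[OF this] obtain t where "\<forall>\<nu>\<in>N. t \<nu> \<in> S \<nu>" ..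
    then have t: "t \<nu> \<in> S \<nu>" if "\<nu> \<in> N" for \<nu> using that by blast
    \<comment> \<open>Applying \<open>T\<close> to the value at \<open>(y, c)\<close> removes
      \<open>y\<close> and turns each \<open>t \<nu> * \<beta> \<nu>\<close> into
      \<open>- V (\<beta> \<nu>)\<close>. As \<open>V\<close> is injective and the
      \<open>\<beta> \<nu>\<close> are independent, \<open>c\<close> is recovered, so
      \<open>card Z * q ^ card N\<close> is at most the order of the field.\<close>
    let ?f = "\<lambda>(y, c). y + (\<Sum>\<nu>\<in>N. c \<nu> * (t \<nu> * \<beta> \<nu>))"
    have f_tr: "tr (u j * (y + (\<Sum>\<nu>\<in>N. c \<nu> * (t \<nu> * \<beta> \<nu>)))) = - tr (v j * (\<Sum>\<nu>\<in>N. c \<nu> * \<beta> \<nu>))"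
      if "y \<in> Z" "c \<in> N \<rightarrow>\<^sub>E B" "j \<in> {1..l}" for y c j
    proof -
      have c: "c \<nu> \<in> B" if "\<nu> \<in> N" for \<nu> using \<open>c \<in> _\<close> that by auto
      have "u j * (y + (\<Sum>\<nu>\<in>N. c \<nu> * (t \<nu> * \<beta> \<nu>))) = u j * y + (\<Sum>\<nu>\<in>N. c \<nu> * (u j * (t \<nu> * \<beta> \<nu>)))"
        by (simp add: distrib_left sum_distrib_left mult.left_commute)
      then have "tr (u j * (y + (\<Sum>\<nu>\<in>N. c \<nu> * (t \<nu> * \<beta> \<nu>)))) =
          (\<Sum>\<nu>\<in>N. c \<nu> * tr (u j * (t \<nu> * \<beta> \<nu>)))"
        using that(1,3) by (simp add: trace_add trace_lin_comb c Z_def)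
      also have "\<dots> = - (\<Sum>\<nu>\<in>N. c \<nu> * tr (v j * \<beta> \<nu>))"
        unfolding sum_negf[symmetric] by (rule sum.cong) (use SD t that(3) in auto)
      also have "(\<Sum>\<nu>\<in>N. c \<nu> * tr (v j * \<beta> \<nu>)) = tr (\<Sum>\<nu>\<in>N. c \<nu> * (v j * \<beta> \<nu>))"
        by (rule trace_lin_comb[symmetric]) (rule c)
      also have "(\<Sum>\<nu>\<in>N. c \<nu> * (v j * \<beta> \<nu>)) = v j * (\<Sum>\<nu>\<in>N. c \<nu> * \<beta> \<nu>)"
        by (simp add: sum_distrib_left mult.left_commute)
      finally show ?thesis .
    qed
    have "inj_on ?f (Z \<times> (N \<rightarrow>\<^sub>E B))"
    proof (rule inj_onI, clarify)
      fix y c y' c' assume *: "y \<in> Z" "c \<in> N \<rightarrow>\<^sub>E B" "y' \<in> Z" "c' \<in> N \<rightarrow>\<^sub>E B"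
        and eq: "y + (\<Sum>\<nu>\<in>N. c \<nu> * (t \<nu> * \<beta> \<nu>)) = y' + (\<Sum>\<nu>\<in>N. c' \<nu> * (t \<nu> * \<beta> \<nu>))"
      have "tr (v j * ((\<Sum>\<nu>\<in>N. c \<nu> * \<beta> \<nu>) - (\<Sum>\<nu>\<in>N. c' \<nu> * \<beta> \<nu>))) = 0" if j: "j \<in> {1..l}" for j
        using f_tr[OF *(1,2) j] f_tr[OF *(3,4) j] eq by (simp add: right_diff_distrib trace_diff)
      then have "(\<Sum>\<nu>\<in>N. c \<nu> * \<beta> \<nu>) - (\<Sum>\<nu>\<in>N. c' \<nu> * \<beta> \<nu>) = 0"
        by (rule trace_nondegenerate[OF v z])
      then have "c = c'"
        using lin_comb_inj_on[OF B lin_indep_over_subset[OF \<beta> N(1) _ B]] *(2,4)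
        by (auto dest: inj_onD)
      then show "y = y' \<and> c = c'" using eq by simp
    qed
    then have "card (Z \<times> (N \<rightarrow>\<^sub>E B)) \<le> card (UNIV :: 'a set)"
      by (intro card_inj_on_le) auto
    then show ?thesis
      using N by (simp add: card_cartesian_product card_funcsetE card_B card_UNIV_eq)
  qed
  have card_N: "card N \<le> l" using card_mono[OF _ N(1)] by simp
  have "card Z * q ^ card N \<le> q ^ (l - card N) * q ^ card N"
    using card_Z card_N by (simp flip: power_add)
  then have Z_le: "card Z \<le> q ^ (l - card N)" using q_ge_2 by simp
  have "(\<Sum>\<nu>\<in>{1..l}. card (S \<nu>)) = (\<Sum>\<nu>\<in>N. card (S \<nu>))"
    by (rule sum.mono_neutral_right) (auto simp: N_def)
  also have "\<dots> \<le> (\<Sum>\<nu>\<in>N. min (q ^ (d - 1)) (q ^ (l - card N)))"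
    by (rule sum_mono) (use card_S_le card_S_le_Z Z_le in \<open>auto intro: order.trans\<close>)
  also have "\<dots> = card N * min (q ^ (d - 1)) (q ^ (l - card N))" by simp
  also have "\<dots> \<le> (l - d + 1) * q ^ (d - 1)"
    by (rule mult_min_power_le) (use q_ge_2 d card_N in auto)
  finally show ?thesis unfolding S_def .
qed

text \<open>The substitution \<open>t = x - a\<close> moves the repaired node to 0. The values of
  the \<open>g j\<close> at \<open>a\<close>, independent by the definition of a scheme, become the
  constants \<open>v j\<close> of the affine systems, and the linear coefficients become the
  \<open>u j\<close>.\<close>

lemma io_cost_lower_bound:
  assumes \<beta>: "lin_indep_over B \<beta> {1..l}" and z: "tr z \<noteq> 0"
    and A_add: "\<And>x y. x \<in> A \<Longrightarrow> y \<in> A \<Longrightarrow> x + y \<in> A"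
    and A_scale: "\<And>c x. c \<in> B \<Longrightarrow> x \<in> A \<Longrightarrow> c * x \<in> A"
    and card_A: "card A = q ^ d" and d: "1 \<le> d" "d < l"
    and g: "linear_repair_scheme B l A (q ^ d - 2) a g"
  shows "(q ^ d - 1) * l \<le> io_cost q l \<beta> A a g + (l - d + 1) * q ^ (d - 1)"
proof -
  have a: "a \<in> A" and v: "lin_indep_over B (\<lambda>j. poly (g j) a) {1..l}"
    using g by (auto simp: linear_repair_scheme_def)
  \<comment> \<open>With \<open>q ^ d \<ge> 2\<close> the subtraction in \<open>q ^ d - 2\<close> is
    not truncated, so the degrees are below exactly 2.\<close>
  have q_le: "q \<le> q ^ d" using d q_ge_2 by (intro self_le_power) auto
  have deg: "degree (g j) \<le> 1" if "j \<in> {1..l}" for j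
  proof -
    have "degree (g j) < q ^ d - (q ^ d - 2)"
      using g that by (simp add: linear_repair_scheme_def card_A)
    then show ?thesis using q_ge_2 q_le by simp
  qed
  have m1: "- 1 \<in> B" using B by (auto simp: is_subfield_def)
  have A_diff: "x - y \<in> A" if "x \<in> A" "y \<in> A" for x y
    using A_add[OF that(1) A_scale[OF m1 that(2)]] by simp
  have g_eq: "poly (g j) x = coeff (g j) 1 * (x - a) + poly (g j) a" if "j \<in> {1..l}" for j x
  proof -
    have "poly (g j) y = coeff (g j) 0 + coeff (g j) 1 * y" for y
      by (subst poly_as_sum_of_monoms'[OF deg[OF that], symmetric])
        (simp add: poly_sum poly_monom)
    then show ?thesis by (simp add: algebra_simps)
  qed
  let ?Z = "\<lambda>\<nu>. {x\<in>A - {a}. \<forall>j\<in>{1..l}. tr (poly (g j) x * \<beta> \<nu>) = 0}"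
  let ?S = "\<lambda>\<nu>. {t\<in>A. \<forall>j\<in>{1..l}. tr ((coeff (g j) 1 * t + poly (g j) a) * \<beta> \<nu>) = 0}"
  have "card (?Z \<nu>) \<le> card (?S \<nu>)" for \<nu>
  proof (rule card_inj_on_le)
    show "inj_on (\<lambda>x. x - a) (?Z \<nu>)" by (rule inj_onI) simp
    show "(\<lambda>x. x - a) ` ?Z \<nu> \<subseteq> ?S \<nu>" using a A_diff by (auto simp del: One_nat_def simp flip: g_eq)
  qed simp
  then have "(\<Sum>\<nu>\<in>{1..l}. card (?Z \<nu>)) \<le> (\<Sum>\<nu>\<in>{1..l}. card (?S \<nu>))" by (intro sum_mono)
  also have "\<dots> \<le> (l - d + 1) * q ^ (d - 1)"
    by (rule sum_card_zero_columns_le) (use assms v in auto)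
  finally show ?thesis using io_cost_add_zero_columns[OF _ a, of q l \<beta> g] by (simp add: card_A)
qed

section \<open>Dual coordinates and the evaluation set of the construction\<close>

lemma trace_dual_nonzero:
  fixes \<beta> \<gamma> :: "nat \<Rightarrow> 'a"
  assumes "trace_dual q l \<beta> \<gamma>" "i \<in> {1..l}"
  shows "\<beta> i \<noteq> 0"
proof
  assume "\<beta> i = 0"
  moreover have "tr (\<beta> i * \<gamma> i) = 1" using assms by (simp add: trace_dual_def)
  ultimately show False by (simp add: trace_0)
qed

text \<open>The coordinates with respect to \<open>\<gamma>\<close> exist by spanning, and the
  traces against \<open>\<beta>\<close> read them off. This also shows that the traces lie in
  \<open>B\<close>.\<close>

lemma trace_dual_coeffs:
  assumes "trace_dual q l \<beta> \<gamma>"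
  shows "w = (\<Sum>i\<in>{1..l}. tr (\<beta> i * w) * \<gamma> i)" "i \<in> {1..l} \<Longrightarrow> tr (\<beta> i * w) \<in> B"
proof -
  have "w \<in> span_over B \<gamma> {1..l}"
    using trace_dual_basis_over[OF assms] by (simp add: basis_over_def)
  then obtain c where c: "\<And>i. i \<in> {1..l} \<Longrightarrow> c i \<in> B" "w = (\<Sum>i\<in>{1..l}. c i * \<gamma> i)"
    unfolding span_over_def by blast
  have tr: "tr (\<beta> i * w) = c i" if "i \<in> {1..l}" for i
    unfolding c(2) using trace_dual_coeff[OF assms order.refl that c(1)] that by simp
  have "(\<Sum>i\<in>{1..l}. tr (\<beta> i * w) * \<gamma> i) = (\<Sum>i\<in>{1..l}. c i * \<gamma> i)"
    by (rule sum.cong) (simp_all add: tr)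
  then show "w = (\<Sum>i\<in>{1..l}. tr (\<beta> i * w) * \<gamma> i)" unfolding c(2)[symmetric] by (rule sym)
  show "i \<in> {1..l} \<Longrightarrow> tr (\<beta> i * w) \<in> B" using tr c(1) by simp
qed

lemma span_over_trace_dual:
  assumes "trace_dual q l \<beta> \<gamma>" "I \<subseteq> {1..l}"
  shows "span_over B \<gamma> I = {w. \<forall>i\<in>{1..l} - I. tr (\<beta> i * w) = 0}"
proof (intro equalityI subsetI)
  fix w assume "w \<in> span_over B \<gamma> I"
  then obtain c where "\<And>i. i \<in> I \<Longrightarrow> c i \<in> B" "w = (\<Sum>i\<in>I. c i * \<gamma> i)"
    unfolding span_over_def by blast
  then show "w \<in> {w. \<forall>i\<in>{1..l} - I. tr (\<beta> i * w) = 0}"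
    using trace_dual_coeff[OF assms, of _ c] by simp
next
  fix w assume w: "w \<in> {w. \<forall>i\<in>{1..l} - I. tr (\<beta> i * w) = 0}"
  have "(\<Sum>i\<in>{1..l}. tr (\<beta> i * w) * \<gamma> i) = (\<Sum>i\<in>I. tr (\<beta> i * w) * \<gamma> i)"
    by (rule sum.mono_neutral_right) (use assms(2) w in auto)
  then have "w = (\<Sum>i\<in>I. tr (\<beta> i * w) * \<gamma> i)"
    using trace_dual_coeffs(1)[OF assms(1), of w] by simp
  also have "\<dots> \<in> span_over B \<gamma> I"
    by (rule span_overI, rule trace_dual_coeffs(2)[OF assms(1)]) (use assms(2) in blast)
  finally show "w \<in> span_over B \<gamma> I" .
qed

lemma constr_W_eq:
  assumes "trace_dual q l \<beta> \<gamma>" "1 \<le> d"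
  shows "constr_W q l d \<beta> = {w. \<forall>i\<in>{2..l - d + 1}. tr (\<beta> i * w) = 0}"
proof -
  have "(\<lambda>x. inverse (\<beta> i) * x) ` trace_kernel q l = {w. tr (\<beta> i * w) = 0}"
    if "i \<in> {2..l - d + 1}" for i
  proof -
    \<comment> \<open>\<open>1 \<le> d\<close> keeps the indices up to \<open>l - d + 1\<close>
      within the range \<open>{1..l}\<close> of the dual bases.\<close>
    have "\<beta> i \<noteq> 0" using assms that by (intro trace_dual_nonzero) auto
    then have "w \<in> (\<lambda>x. inverse (\<beta> i) * x) ` trace_kernel q l" if "tr (\<beta> i * w) = 0" for w
      using that by (intro image_eqI[of _ _ "\<beta> i * w"]) (simp_all add: trace_kernel_def flip: mult.assoc)
    then show ?thesis
      using \<open>\<beta> i \<noteq> 0\<close> by (auto simp: trace_kernel_def simp flip: mult.assoc)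
  qed
  then show ?thesis unfolding constr_W_def by auto
qed

text \<open>\<open>constr_W\<close> consists of the elements whose coordinates
  \<open>2, \<dots>, l - d + 1\<close> vanish, so the other \<open>d\<close> vectors of
  \<open>\<gamma>\<close> form a basis of it; dividing them by \<open>\<alpha>\<close> gives a basis
  of \<open>constr_A\<close>.\<close>

lemma constr_A_eq_span_over:
  assumes dual: "trace_dual q l \<beta> \<gamma>" and d: "1 \<le> d" "d < l" and \<alpha>: "\<alpha> \<noteq> 0"
  shows "\<exists>v. lin_indep_over B v {1..d} \<and> constr_A q l d \<beta> \<alpha> = span_over B v {1..d}"
proof -
  \<comment> \<open>\<open>h\<close> enumerates the remaining indices
    \<open>1, l - d + 2, \<dots>, l\<close>.\<close>
  define h where "h i = (if i = 1 then 1 else l - d + i)" for i :: nat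
  have inj: "inj_on h {1..d}" using d by (auto simp: h_def inj_on_def)
  have "h ` {1..d} = insert 1 {l - d + 2..l}"
  proof (intro equalityI subsetI)
    fix i assume "i \<in> insert 1 {l - d + 2..l}"
    then show "i \<in> h ` {1..d}"
      using d by (intro image_eqI[of _ _ "if i = 1 then 1 else i - (l - d)"]) (auto simp: h_def)
  qed (use d in \<open>auto simp: h_def\<close>)
  then have h: "{1..l} - h ` {1..d} = {2..l - d + 1}" "h ` {1..d} \<subseteq> {1..l}" using d by auto
  have "lin_indep_over B \<gamma> {1..l}"
    using trace_dual_basis_over[OF dual] by (simp add: basis_over_def)
  then have indep: "lin_indep_over B (\<lambda>i. \<gamma> (h i)) {1..d}"
    by (intro lin_indep_over_reindex[OF inj] lin_indep_over_subset[OF _ h(2) _ B]) simp_all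
  have W: "constr_W q l d \<beta> = span_over B (\<lambda>i. \<gamma> (h i)) {1..d}"
    using constr_W_eq[OF dual d(1)] span_over_trace_dual[OF dual h(2)] h(1)
      span_over_reindex[OF inj, of B \<gamma>] by simp
  have A: "constr_A q l d \<beta> \<alpha> = (\<lambda>x. x * inverse \<alpha>) ` constr_W q l d \<beta>"
  proof (intro equalityI subsetI)
    fix x assume "x \<in> constr_A q l d \<beta> \<alpha>"
    then show "x \<in> (\<lambda>x. x * inverse \<alpha>) ` constr_W q l d \<beta>"
      using \<alpha> by (intro image_eqI[of _ _ "x * \<alpha>"]) (simp_all add: constr_A_def constr_L_def)
  qed (use \<alpha> in \<open>auto simp: constr_A_def constr_L_def mult.assoc\<close>)
  show ?thesis
  proof (intro exI conjI)
    show "lin_indep_over B (\<lambda>i. \<gamma> (h i) * inverse \<alpha>) {1..d}"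
      by (rule lin_indep_over_mult_right[OF indep]) (use \<alpha> in simp)
    show "constr_A q l d \<beta> \<alpha> = span_over B (\<lambda>i. \<gamma> (h i) * inverse \<alpha>) {1..d}"
      unfolding A W span_over_mult_right ..
  qed
qed

section \<open>Zero columns of the constructed scheme\<close>

text \<open>
  Multiplication by an element of the intermediate field \<open>E\<close> preserves the sum of the summands
  \<open>\<mu> k * E\<close> with \<open>k \<ge> 2\<close>, on which the traces against \<open>\<beta> 1, \<dots>, \<beta> m\<close> vanish.
\<close>

lemma trace_mult_tower_eq_0:
  assumes dual: "trace_dual q l \<beta> \<gamma>" and m: "m \<ge> 1" "m dvd l"
    and E: "is_subfield E" "basis_over B \<gamma> {1..m} E"
    and \<gamma>: "\<And>i j. i \<in> {1..l div m} \<Longrightarrow> j \<in> {1..m} \<Longrightarrow> \<gamma> ((i - 1) * m + j) = \<mu> i * \<gamma> j"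
    and u: "u \<in> span_over B \<gamma> {m + 1..l}" and j: "j \<in> {1..m}" and \<nu>: "\<nu> \<in> {1..m}"
  shows "tr (\<beta> \<nu> * (\<gamma> j * u)) = 0"
proof (cases "l = 0")
  case False
  have ml: "m \<le> l" using m False by (auto dest: dvd_imp_le)
  have E_mult: "\<gamma> j * \<gamma> i \<in> E" if "i \<in> {1..m}" for i
    using span_over_superset[OF B, of "{1..m}" _ \<gamma>] E j that
    by (auto simp: basis_over_def is_subfield_def)
  have basis: "tr (\<beta> \<nu> * (\<gamma> j * \<gamma> i)) = 0" if i: "i \<in> {m + 1..l}" for i
  proof -
    \<comment> \<open>The index \<open>i\<close> sits at position \<open>h\<close> of block
      \<open>k\<close>; the shifts by 1 arise because blocks and positions are numbered from
      1.\<close>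
    define k h where "k = (i - 1) div m + 1" and "h = (i - 1) mod m + 1"
    have i_eq: "i = (k - 1) * m + h" using i by (simp add: k_def h_def)
    have "m div m \<le> (i - 1) div m" using i by (intro div_le_mono) auto
    then have "(i - 1) div m \<ge> 1" using m by simp
    moreover have "(i - 1) div m < l div m"
      using i m by (auto simp: div_less_iff_less_mult)
    ultimately have k: "k \<in> {1..l div m}" "k \<ge> 2" unfolding k_def by auto
    have h: "h \<in> {1..m}" using m by (simp add: h_def Suc_le_eq)
    obtain c where c: "\<And>i. i \<in> {1..m} \<Longrightarrow> c i \<in> B" "\<gamma> j * \<gamma> h = (\<Sum>i\<in>{1..m}. c i * \<gamma> i)"
      using E_mult[OF h] E(2) unfolding basis_over_def span_over_def by blast
    have "\<gamma> j * \<gamma> i = \<mu> k * (\<gamma> j * \<gamma> h)" unfolding i_eq \<gamma>[OF k(1) h] by (simp add: ac_simps)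
    also have "\<dots> = (\<Sum>i\<in>{1..m}. c i * \<gamma> ((k - 1) * m + i))"
      unfolding c(2) sum_distrib_left
    proof (rule sum.cong)
      fix i assume i: "i \<in> {1..m}"
      show "\<mu> k * (c i * \<gamma> i) = c i * \<gamma> ((k - 1) * m + i)"
        unfolding \<gamma>[OF k(1) i] by (rule mult.left_commute)
    qed simp
    finally have "\<beta> \<nu> * (\<gamma> j * \<gamma> i) = (\<Sum>i\<in>{1..m}. c i * (\<beta> \<nu> * \<gamma> ((k - 1) * m + i)))"
      by (simp add: sum_distrib_left mult.left_commute)
    then have "tr (\<beta> \<nu> * (\<gamma> j * \<gamma> i)) = (\<Sum>i\<in>{1..m}. c i * tr (\<beta> \<nu> * \<gamma> ((k - 1) * m + i)))"
      by (simp only: trace_lin_comb[of "{1..m}" c, OF c(1)])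
    also have "\<dots> = 0"
    proof (intro sum.neutral ballI)
      fix i assume i: "i \<in> {1..m}"
      \<comment> \<open>As \<open>k \<ge> 2\<close>, every index of block \<open>k\<close> exceeds
        \<open>m\<close>, whereas \<open>\<nu> \<le> m\<close>; by duality the trace is 0.\<close>
      define p where "p = (k - 1) * m"
      have "1 * m \<le> p" unfolding p_def using k by (intro mult_right_mono) auto
      moreover have "p + m \<le> l"
      proof -
        have "p + m = k * m" using k by (simp add: p_def algebra_simps)
        also have "\<dots> \<le> l" using k m by (simp add: less_eq_div_iff_mult_less_eq)
        finally show ?thesis .
      qed
      ultimately have "p + i \<in> {1..l}" "p + i \<noteq> \<nu>" "\<nu> \<in> {1..l}"
        using i \<nu> ml by auto
      then have "tr (\<beta> \<nu> * \<gamma> (p + i)) = 0" using dual by (simp add: trace_dual_def)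
      then show "c i * tr (\<beta> \<nu> * \<gamma> ((k - 1) * m + i)) = 0" by (simp add: p_def)
    qed
    finally show ?thesis .
  qed
  obtain c where c: "\<And>i. i \<in> {m + 1..l} \<Longrightarrow> c i \<in> B" "u = (\<Sum>i\<in>{m + 1..l}. c i * \<gamma> i)"
    using u unfolding span_over_def by blast
  have "\<beta> \<nu> * (\<gamma> j * u) = (\<Sum>i\<in>{m + 1..l}. c i * (\<beta> \<nu> * (\<gamma> j * \<gamma> i)))"
    unfolding c(2) by (simp add: sum_distrib_left mult.left_commute)
  then have "tr (\<beta> \<nu> * (\<gamma> j * u)) = (\<Sum>i\<in>{m + 1..l}. c i * tr (\<beta> \<nu> * (\<gamma> j * \<gamma> i)))"
    by (simp only: trace_lin_comb[of "{m + 1..l}" c, OF c(1)])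
  then show ?thesis using basis by simp
qed (simp add: field_trace_def)

lemma poly_constr_scheme:
  "poly (constr_scheme m \<gamma> \<alpha> j) x = (if j \<le> m then \<gamma> j * (\<alpha> * x + 1) else \<gamma> j)"
  by (simp add: constr_scheme_def constr_L_def algebra_simps)

lemma degree_constr_scheme: "degree (constr_scheme m \<gamma> \<alpha> j) \<le> 1"
  by (simp add: constr_scheme_def constr_L_def)

text \<open>For \<open>\<nu> > m\<close> row \<open>\<nu>\<close> is the constant
  \<open>\<gamma> \<nu>\<close>, whose trace against \<open>\<beta> \<nu>\<close> is 1, so the
  column never vanishes. For \<open>\<nu> \<le> m\<close> it vanishes exactly where
  \<open>\<alpha> * x + 1\<close> lies in the span of
  \<open>\<gamma> (m + 1), \<dots>, \<gamma> l\<close>, a condition independent of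
  \<open>\<nu>\<close> with \<open>q ^ (l - m) = q ^ (d - 1)\<close> solutions.\<close>

lemma constr_scheme_zero_columns:
  assumes dual: "trace_dual q l \<beta> \<gamma>" and d: "1 \<le> d" "d < l" and m: "m = l - d + 1" "m dvd l"
    and E: "is_subfield E" "basis_over B \<gamma> {1..m} E" and \<gamma>1: "\<gamma> 1 = 1"
    and \<gamma>: "\<And>i j. i \<in> {1..l div m} \<Longrightarrow> j \<in> {1..m} \<Longrightarrow> \<gamma> ((i - 1) * m + j) = \<mu> i * \<gamma> j"
    and \<alpha>: "\<alpha> \<noteq> 0" and \<nu>: "\<nu> \<in> {1..l}"
  shows "card {x\<in>constr_A q l d \<beta> \<alpha> - {0}.
      \<forall>j\<in>{1..l}. tr (poly (constr_scheme m \<gamma> \<alpha> j) x * \<beta> \<nu>) = 0} =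
    (if \<nu> \<le> m then q ^ (d - 1) else 0)" (is "card ?Z = _")
proof (cases "\<nu> \<le> m")
  case True
  then have \<nu>m: "\<nu> \<in> {1..m}" using \<nu> by simp
  have ml: "m \<le> l" "m \<ge> 1" using d m by auto
  have "{1..l} - {m + 1..l} = {1..m}" using ml by auto
  then have U: "span_over B \<gamma> {m + 1..l} = {u. \<forall>i\<in>{1..m}. tr (\<beta> i * u) = 0}"
    using span_over_trace_dual[OF dual, of "{m + 1..l}"] by simp
  have tr_\<beta>\<gamma>: "tr (\<beta> i * \<gamma> j) = (if i = j then 1 else 0)" if "i \<in> {1..l}" "j \<in> {1..l}" for i j
    using dual that by (simp add: trace_dual_def)
  have tr_\<beta>1: "tr (\<beta> i) = (if i = 1 then 1 else 0)" if "i \<in> {1..l}" for i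
    using tr_\<beta>\<gamma>[OF that, of 1] \<gamma>1 d by simp
  have A: "x \<in> constr_A q l d \<beta> \<alpha> \<longleftrightarrow> (\<forall>i\<in>{2..m}. tr (\<beta> i * (\<alpha> * x)) = 0)" for x
    using constr_W_eq[OF dual d(1)] by (simp add: constr_A_def constr_L_def m mult.commute)
  have "?Z = {x. \<alpha> * x + 1 \<in> span_over B \<gamma> {m + 1..l}}"
  proof (intro equalityI subsetI)
    fix x assume x: "x \<in> ?Z"
    \<comment> \<open>\<open>c\<close> is the first coordinate of \<open>\<alpha> * x\<close>.
      Coordinates \<open>2, \<dots>, m\<close> vanish on \<open>constr_A\<close>, and
      \<open>\<gamma> 1 = 1\<close>, so subtracting \<open>c\<close> leaves an element of the span
      of the later blocks.\<close>
    define c where "c = tr (\<beta> 1 * (\<alpha> * x))"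
    have c: "c \<in> B" using trace_dual_coeffs(2)[OF dual] d by (simp add: c_def)
    have tr_c: "tr (c * y) = c * tr y" for y by (rule trace_mult_left[OF c])
    have s: "\<alpha> * x - c \<in> span_over B \<gamma> {m + 1..l}"
      unfolding U
    proof (intro CollectI ballI)
      fix i assume i: "i \<in> {1..m}"
      have "tr (\<beta> i * (\<alpha> * x - c)) = tr (\<beta> i * (\<alpha> * x)) - c * tr (\<beta> i)"
        by (simp add: right_diff_distrib trace_diff mult.commute[of _ c] tr_c)
      then show "tr (\<beta> i * (\<alpha> * x - c)) = 0"
        using x i A[of x] tr_\<beta>1[of i] ml by (cases "i = 1") (auto simp: c_def)
    qed
    \<comment> \<open>Row \<open>\<nu>\<close> alone forces \<open>c = - 1\<close>: the part in the
      later blocks contributes trace 0, and the rest contributes \<open>c + 1\<close>.\<close>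
    have "tr (poly (constr_scheme m \<gamma> \<alpha> \<nu>) x * \<beta> \<nu>) = 0" using x \<nu> by blast
    then have "0 = tr (\<beta> \<nu> * (\<gamma> \<nu> * (\<alpha> * x + 1)))"
      using True by (simp add: poly_constr_scheme mult.commute)
    also have "\<beta> \<nu> * (\<gamma> \<nu> * (\<alpha> * x + 1)) =
        \<beta> \<nu> * (\<gamma> \<nu> * (\<alpha> * x - c)) + (c * (\<beta> \<nu> * \<gamma> \<nu>) + \<beta> \<nu> * \<gamma> \<nu>)"
      by (simp add: algebra_simps)
    also have "tr \<dots> = c + 1"
      using trace_mult_tower_eq_0[OF dual ml(2) m(2) E \<gamma> s \<nu>m \<nu>m] tr_\<beta>\<gamma>[OF \<nu> \<nu>]
      by (simp add: trace_add tr_c)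
    finally have "c = - 1" by (simp add: eq_neg_iff_add_eq_0)
    then show "x \<in> {x. \<alpha> * x + 1 \<in> span_over B \<gamma> {m + 1..l}}" using s by simp
  next
    fix x assume "x \<in> {x. \<alpha> * x + 1 \<in> span_over B \<gamma> {m + 1..l}}"
    then have x: "\<alpha> * x + 1 \<in> span_over B \<gamma> {m + 1..l}" by simp
    have tr_x: "tr (\<beta> i * (\<alpha> * x)) + tr (\<beta> i) = 0" if "i \<in> {1..m}" for i
      using x that unfolding U by (simp add: distrib_left trace_add)
    have "x \<in> constr_A q l d \<beta> \<alpha>" unfolding A
    proof
      fix i assume "i \<in> {2..m}"
      then show "tr (\<beta> i * (\<alpha> * x)) = 0" using tr_x[of i] tr_\<beta>1[of i] ml by simp
    qed
    \<comment> \<open>At \<open>x = 0\<close> the element \<open>\<alpha> * x + 1\<close> would be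
      \<open>\<gamma> 1\<close>, whose first coordinate is 1 and not 0.\<close>
    moreover have "x \<noteq> 0" using tr_x[of 1] tr_\<beta>1[of 1] ml by (auto simp: trace_0)
    \<comment> \<open>Rows \<open>j \<le> m\<close> vanish by the tower argument; rows
      \<open>j > m\<close> are constants \<open>\<gamma> j\<close> with
      \<open>j \<noteq> \<nu>\<close>, so duality applies.\<close>
    moreover have "tr (poly (constr_scheme m \<gamma> \<alpha> j) x * \<beta> \<nu>) = 0" if j: "j \<in> {1..l}" for j
      using trace_mult_tower_eq_0[OF dual ml(2) m(2) E \<gamma> x _ \<nu>m, of j] tr_\<beta>\<gamma>[OF \<nu> j] j True
      by (auto simp: poly_constr_scheme mult.commute)
    ultimately show "x \<in> ?Z" by simp
  qed
  also have "\<dots> = (\<lambda>u. (u - 1) / \<alpha>) ` span_over B \<gamma> {m + 1..l}"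
  proof (intro equalityI subsetI)
    fix x assume "x \<in> {x. \<alpha> * x + 1 \<in> span_over B \<gamma> {m + 1..l}}"
    then show "x \<in> (\<lambda>u. (u - 1) / \<alpha>) ` span_over B \<gamma> {m + 1..l}"
      using \<alpha> by (intro image_eqI[of _ _ "\<alpha> * x + 1"]) simp_all
  qed (use \<alpha> in auto)
  also have "card \<dots> = card (span_over B \<gamma> {m + 1..l})"
    using \<alpha> by (intro card_image inj_onI) simp
  also have "\<dots> = q ^ card {m + 1..l}"
    using trace_dual_basis_over[OF dual]
    by (subst card_span_over[OF B lin_indep_over_subset[of B \<gamma> "{1..l}"]])
      (auto simp: basis_over_def card_B B)
  also have "card {m + 1..l} = d - 1" using d m by simp
  finally show ?thesis using True by simp
next
  case False
  then have "tr (poly (constr_scheme m \<gamma> \<alpha> \<nu>) x * \<beta> \<nu>) \<noteq> 0" for x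
    using dual \<nu> by (simp add: poly_constr_scheme trace_dual_def mult.commute)
  then have "?Z = {}" using \<nu> by blast
  then show ?thesis using False by simp
qed

end

section \<open>The construction attains the lower bound\<close>

theorem corollary23:
  fixes B E :: "'a::finite_field set"
    and q l d m :: nat
    and \<gamma> \<mu> \<beta> :: "nat \<Rightarrow> 'a"
    and \<alpha> :: 'a
  assumes q: "primepow q" and l: "l > 1" and d: "d < l"
    and m: "m = l - d + 1" and m_dvd: "m dvd l"
    and F: "card (UNIV :: 'a set) = q ^ l"
    and B: "is_subfield B" "card B = q"
    and E: "is_subfield E" "card E = q ^ m"
    and \<gamma>_E: "basis_over B \<gamma> {1..m} E" "\<gamma> 1 = 1"
    and \<mu>: "basis_over E \<mu> {1..l div m} UNIV" "\<mu> 1 = 1"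
    and \<gamma>_F: "\<And>i j. i \<in> {1..l div m} \<Longrightarrow> j \<in> {1..m} \<Longrightarrow> \<gamma> ((i - 1) * m + j) = \<mu> i * \<gamma> j"
    and \<beta>: "trace_dual q l \<beta> \<gamma>"
    and \<alpha>: "\<alpha> \<noteq> 0"
  shows "basis_over B \<gamma> {1..l} UNIV \<and> basis_over B \<beta> {1..l} UNIV \<and>
    subspace_of_dim B d (constr_A q l d \<beta> \<alpha>) \<and>
    card (constr_A q l d \<beta> \<alpha>) = q ^ d \<and>
    linear_repair_scheme B l (constr_A q l d \<beta> \<alpha>) (q ^ d - 2) 0 (constr_scheme m \<gamma> \<alpha>) \<and>
    (\<forall>c \<in> RS_code (constr_A q l d \<beta> \<alpha>) (q ^ d - 2). \<forall>j\<in>{1..l}.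
      (\<Sum>x \<in> constr_A q l d \<beta> \<alpha>. poly (constr_scheme m \<gamma> \<alpha> j) x * c x) = 0) \<and>
    int (io_cost q l \<beta> (constr_A q l d \<beta> \<alpha>) 0 (constr_scheme m \<gamma> \<alpha>)) =
      (int (q ^ d) - 1) * int l - (int l - int d + 1) * int (q ^ (d - 1)) \<and>
    (\<forall>a g \<beta>'. linear_repair_scheme B l (constr_A q l d \<beta> \<alpha>) (q ^ d - 2) a g \<longrightarrow>
      basis_over B \<beta>' {1..l} UNIV \<longrightarrow>
      io_cost q l \<beta> (constr_A q l d \<beta> \<alpha>) 0 (constr_scheme m \<gamma> \<alpha>)
        \<le> io_cost q l \<beta>' (constr_A q l d \<beta> \<alpha>) a g)"
proof -
  interpret F: trace_field B q l by unfold_locales (rule q F B)+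
  \<comment> \<open>For \<open>d = 0\<close> one would have \<open>m = l + 1\<close>, which cannot
    divide \<open>l\<close>.\<close>
  have d1: "1 \<le> d" using m m_dvd l by (cases "d = 0") (auto dest: dvd_imp_le)
  define A where "A = constr_A q l d \<beta> \<alpha>"
  let ?g = "constr_scheme m \<gamma> \<alpha>"
  have basis_\<gamma>: "basis_over B \<gamma> {1..l} UNIV" by (rule F.trace_dual_basis_over[OF \<beta>])
  have basis_\<beta>: "basis_over B \<beta> {1..l} UNIV"
    by (rule F.trace_dual_basis_over[OF F.trace_dual_commute[OF \<beta>]])
  obtain v where v: "lin_indep_over B v {1..d}" and A_span: "A = span_over B v {1..d}"
    using F.constr_A_eq_span_over[OF \<beta> d1 d \<alpha>] unfolding A_def by blast
  have A: "subspace_of_dim B d A"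
    unfolding A_span by (rule subspace_of_dim_span_over[OF B(1) v])
  then have A0: "0 \<in> A"
    and A_add: "\<And>x y. x \<in> A \<Longrightarrow> y \<in> A \<Longrightarrow> x + y \<in> A"
    and A_scale: "\<And>c x. c \<in> B \<Longrightarrow> x \<in> A \<Longrightarrow> c * x \<in> A"
    by (simp_all add: subspace_of_dim_def)
  have A_diff: "x - y \<in> A" if "x \<in> A" "y \<in> A" for x y
    using A_add[OF that(1) A_scale[of "- 1", OF _ that(2)]] B(1) by (simp add: is_subfield_def)
  have card_A: "card A = q ^ d"
    using card_span_over[OF B(1) v] by (simp add: A_span B(2))
  have "q \<le> q ^ d" using d1 F.q_ge_2 by (intro self_le_power) auto
  then have qd: "2 \<le> q ^ d" using F.q_ge_2 by simp
  \<comment> \<open>Duality provides an element of trace 1, the witness of a nonzero trace for the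
    lower bound.\<close>
  have z: "F.tr (\<beta> 1 * \<gamma> 1) \<noteq> 0" using \<beta> l by (simp add: trace_dual_def)
  have scheme: "linear_repair_scheme B l A (q ^ d - 2) 0 ?g"
  proof -
    have "degree (?g j) < card A - (q ^ d - 2)" for j
      using F.degree_constr_scheme[of m \<gamma> \<alpha> j] qd by (simp add: card_A)
    \<comment> \<open>\<open>L\<close> vanishes at 0, so every scheme polynomial takes the value
      \<open>\<gamma> j\<close> there.\<close>
    moreover have "(\<lambda>j. poly (?g j) 0) = \<gamma>" by (simp add: fun_eq_iff F.poly_constr_scheme)
    ultimately show ?thesis
      using A0 basis_\<gamma> by (simp add: linear_repair_scheme_def basis_over_def)
  qed
  \<comment> \<open>A codeword polynomial times a scheme polynomial has degree at most
    \<open>q ^ d - 2\<close>, just small enough for its values on the additive group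
    \<open>A\<close> to sum to 0. Hence the scheme polynomials evaluate to dual codewords.\<close>
  have dual: "(\<Sum>x\<in>A. poly (?g j) x * c x) = 0" if c: "c \<in> RS_code A (q ^ d - 2)" for c j
  proof -
    obtain f where f: "f = 0 \<or> degree f < q ^ d - 2" and c_eq: "c = (\<lambda>x. if x \<in> A then poly f x else 0)"
      using c unfolding RS_code_def by blast
    have "(\<Sum>x\<in>A. poly (?g j) x * c x) = (\<Sum>x\<in>A. poly (?g j * f) x)"
      by (rule sum.cong) (simp_all add: c_eq)
    also have "\<dots> = 0"
    proof (cases "f = 0")
      case False
      have "degree (?g j * f) \<le> 1 + degree f"
        using degree_mult_le[of "?g j" f] F.degree_constr_scheme[of m \<gamma> \<alpha> j] by linarith
      then show ?thesis
        using f False by (intro sum_poly_additive_subgroup_eq_0 A_diff) (auto simp: card_A)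
    qed simp
    finally show ?thesis .
  qed
  have "(\<Sum>\<nu>\<in>{1..l}. card {x\<in>A - {0}. \<forall>j\<in>{1..l}. F.tr (poly (?g j) x * \<beta> \<nu>) = 0}) =
      (\<Sum>\<nu>\<in>{1..l}. if \<nu> \<le> m then q ^ (d - 1) else 0)"
    unfolding A_def
    by (intro sum.cong refl F.constr_scheme_zero_columns[OF \<beta> d1 d m m_dvd E(1) \<gamma>_E \<gamma>_F \<alpha>])
  also have "\<dots> = (\<Sum>\<nu>\<in>{1..m}. q ^ (d - 1))"
    by (rule sum.mono_neutral_cong_right) (use m d1 d in auto)
  finally have cost: "io_cost q l \<beta> A 0 ?g + m * q ^ (d - 1) = (q ^ d - 1) * l"
    using io_cost_add_zero_columns[OF _ A0, of q l \<beta> ?g] by (simp add: card_A)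
  have "int (q ^ d - 1) = int (q ^ d) - 1" "int m = int l - int d + 1"
    using qd d m by (simp_all add: of_nat_diff)
  moreover have "int (io_cost q l \<beta> A 0 ?g) = int (q ^ d - 1) * int l - int m * int (q ^ (d - 1))"
    using cost by (simp only: flip: of_nat_mult)
  ultimately have cost_int: "int (io_cost q l \<beta> A 0 ?g) =
      (int (q ^ d) - 1) * int l - (int l - int d + 1) * int (q ^ (d - 1))"
    by (simp only:)
  have "io_cost q l \<beta> A 0 ?g \<le> io_cost q l \<beta>' A a g"
    if "linear_repair_scheme B l A (q ^ d - 2) a g" "basis_over B \<beta>' {1..l} UNIV" for a g \<beta>'
  proof -
    have "lin_indep_over B \<beta>' {1..l}" using that(2) by (simp add: basis_over_def)
    \<comment> \<open>The bound falls short of \<open>(q ^ d - 1) * l\<close> by the same amount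
      \<open>m * q ^ (d - 1)\<close> as the cost of the construction.\<close>
    from F.io_cost_lower_bound[OF this z A_add A_scale card_A d1 d that(1)]
    show ?thesis using cost m by simp
  qed
  then show ?thesis
    unfolding A_def[symmetric]
    using basis_\<gamma> basis_\<beta> A card_A scheme dual cost_int by blast
qed

end
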